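(* Let $t \geq 6$ be an integer. Write $\lfloor \sqrt{2^{t+1}} + 0.5\rfloor - 4 = 3a+b$ with $a\in\mathbb{Z}_{\geq 0}$ and $b\in\{0,1,2\}$, put $\varepsilon = \sqrt{2^{t+1}} + 0.5 - \lfloor \sqrt{2^{t+1}} + 0.5\rfloor \in[0,1)$, and define \[ \lambda_{a,b,\varepsilon} = \begin{cases} 1 &\text{ for $a$ odd and $b=0$},\\ 2 &\text{ for $a$ odd, $b=1$ and $0\leq\varepsilon \leq 1-\frac{1}{2^{(t-4)/2}}$},\\ 1 &\text{ for $a$ odd, $b=1$ and $1-\frac{1}{2^{(t-4)/2}} < \varepsilon<1$},\\ 2 &\text{ for $a$ odd and $b=2$},\\ 2 &\text{ for $a$ even, $b=0$ and $0\leq\varepsilon \leq 0.5$},\\ 1 &\text{ for $a$ even, $b=0$ and $0.5<\varepsilon<1$},\\ 2 &\text{ for $a$ even, $b=1$ and $0\leq\varepsilon \leq 1-\frac{1}{2^{(t-5)/2}}$},\\ 1 &\text{ for $a$ even, $b=1$ and $1-\frac{1}{2^{(t-5)/2}} < \varepsilon \leq 1-\frac{1}{2^{(t+7)/2}}$},\\ 0 &\text{ for $a$ even, $b=1$ and $1-\frac{1}{2^{(t+7)/2}} < \varepsilon<1$},\\ 0 &\text{ for $a$ even and $b=2$}. \end{cases} \] Let $n_t = \lfloor \sqrt{2^{t+1}} + 0.5\rfloor - \lambda_{a,b,\varepsilon}$. Then there is no binary linear code of length $n_t$, dimension $n_t - t$ and minimum distance $5$, and consequently \[ s_{\max}(t)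 \leq \begin{cases} 2^{\frac{t+1}{2}} - 2 &\text{ for $t$ odd},\\ \lfloor \sqrt{2^{t+1}} + 0.5\rfloor - \lambda_{a,b,\varepsilon} &\text{ for $t$ even}. \end{cases} \]
   Context: $\mathbb{F}_2^t$ denotes the $t$-dimensional vector space over the binary field $\mathbb{F}_2$. A subset $M\subseteq \mathbb{F}_2^t$ is called Sidon if $m_1+m_2\neq m_3+m_4$ for all pairwise distinct $m_1,m_2,m_3,m_4\in M$. $s_{\max}(t)$ denotes the maximum size of a Sidon set in $\mathbb{F}_2^t$. A binary linear code of length $n$ and dimension $k$ is a $k$-dimensional subspace of $\mathbb{F}_2^n$; its minimum distance is the minimum Hamming weight (number of nonzero entries) of its nonzero codewords. *)

theory Defs
  imports "HOL-Analysis.Analysis" "HOL-Library.Z2" "HOL-Library.Function_Algebras"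
begin

text \<open>Vectors of F_2^n are modelled as functions nat => bit vanishing outside {0..<n}.\<close>

definition binvec :: "nat \<Rightarrow> (nat \<Rightarrow> bit) set" where
  "binvec n = {v. \<forall>i\<ge>n. v i = 0}"

definition F2scale :: "bit \<Rightarrow> (nat \<Rightarrow> bit) \<Rightarrow> (nat \<Rightarrow> bit)" where
  "F2scale c v = (\<lambda>i. c * v i)"

definition hweight :: "(nat \<Rightarrow> bit) \<Rightarrow> nat" where
  "hweight v = card {i. v i \<noteq> 0}"

definition bin_linear_code :: "nat \<Rightarrow> nat \<Rightarrow> nat \<Rightarrow> (nat \<Rightarrow> bit) set \<Rightarrow> bool" where
  "bin_linear_code n k d C \<longleftrightarrow>
     C \<subseteq> binvec n \<and> module.subspace F2scale C \<and> vector_space.dim F2scale C = k \<and>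
     Min (hweight ` (C - {0})) = d"

definition sidon :: "(nat \<Rightarrow> bit) set \<Rightarrow> bool" where
  "sidon M \<longleftrightarrow> (\<forall>m1\<in>M. \<forall>m2\<in>M. \<forall>m3\<in>M. \<forall>m4\<in>M.
      distinct [m1, m2, m3, m4] \<longrightarrow> m1 + m2 \<noteq> m3 + m4)"

definition smax :: "nat \<Rightarrow> nat" where
  "smax t = Max (card ` {M. M \<subseteq> binvec t \<and> sidon M})"

definition Nt :: "nat \<Rightarrow> int" where
  "Nt t = \<lfloor>sqrt (2 ^ (t + 1)) + 1/2\<rfloor>"

definition epst :: "nat \<Rightarrow> real" where
  "epst t = sqrt (2 ^ (t + 1)) + 1/2 - of_int (Nt t)"

definition lam :: "nat \<Rightarrow> int" where
  "lam t = (let a = (Nt t - 4) div 3; b = (Nt t - 4) mod 3; e = epst t in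
     if odd a then
       (if b = 0 then 1
        else if b = 1 then (if e \<le> 1 - 1 / 2 powr ((real t - 4) / 2) then 2 else 1)
        else 2)
     else
       (if b = 0 then (if e \<le> 1/2 then 2 else 1)
        else if b = 1 then
          (if e \<le> 1 - 1 / 2 powr ((real t - 5) / 2) then 2
           else if e \<le> 1 - 1 / 2 powr ((real t + 7) / 2) then 1 else 0)
        else 0))"

definition n_t :: "nat \<Rightarrow> int" where
  "n_t t = Nt t - lam t"

end

theory Submission
  imports Defs
begin

text \<open>
  A code with the given parameters yields a Sidon set \<open>S\<close> of size \<open>s = n\<^sub>t + 1\<close> in
  \<open>V = F\<^sub>2\<^sup>t\<close>, namely \<open>0\<close> and the columns of a parity check matrix.
  Let \<open>U\<close> consist of the nonzero vectors that are not sums of two distinct points of \<open>S\<close>, so that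
  \<open>2|U| = 2\<^bsup>t+1\<^esup> - 2 - s(s - 1)\<close>.  For \<open>p \<notin> S\<close> put \<open>W(p) = {a \<in> S. p + a \<in> U}\<close>.  The remaining
  points of \<open>S\<close> split into \<open>N\<close> disjoint triples with sum \<open>p\<close>, whence
  \<open>s = |W(p)| + 3N\<close> and \<open>\<Sum>S = \<Sum>W(p) + N p\<close>.  The first equation fixes \<open>|W(p)|\<close> modulo 3 (Johnson bound);
  the second, combined with the parity of \<open>s\<close>, makes the smallest value of \<open>|W(p)|\<close> in its residue
  class exceptional unless \<open>s\<close> is 0 or 5 modulo 6.  As the \<open>|W(p)|\<close> sum to \<open>s|U|\<close> over all \<open>p \<notin> S\<close>, this
  bounds \<open>|U|\<close> from below, which fails for \<open>s = n\<^sub>t + 1\<close>.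
\<close>

section \<open>Triples in Sidon sets of elementary abelian 2-groups\<close>

text \<open>Exponent 2 is asked of the whole type, while \<open>V\<close> is a finite subgroup in
  it. The Sidon property appears as uniqueness of the unordered pair behind a sum, the form in which
  triples are compared.\<close>

locale sidon_subset =
  fixes V S :: "'a :: ab_group_add set"
  assumes add_self: "\<And>x :: 'a. x + x = 0"
    and finite_V: "finite V"
    and zero_in_V: "0 \<in> V"
    and add_in_V: "\<And>x y. x \<in> V \<Longrightarrow> y \<in> V \<Longrightarrow> x + y \<in> V"
    and S_subset_V: "S \<subseteq> V"
    and sidon_eq: "\<And>a b c d. \<lbrakk>a \<in> S; b \<in> S; c \<in> S; d \<in> S; a \<noteq> b; a + b = c + d\<rbrakk> \<Longrightarrow> {a, b} = {c, d}"
begin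

lemma add_self_left: "x + (x + y) = (y :: 'a)"
  by (simp add: add.assoc [symmetric] add_self)

lemma add_eq_swap: "x + y = z \<longleftrightarrow> x = z + (y :: 'a)"
  by (metis add.assoc add.right_neutral add_self)

lemma add_eq_0_iff_eq: "x + y = 0 \<longleftrightarrow> x = (y :: 'a)"
  by (simp add: add_eq_swap)

lemma finite_S: "finite S"
  using finite_V S_subset_V finite_subset by blast

text \<open>Summing over two-element subsets instead of ordered pairs turns the Sidon property into
  injectivity of the sum map.\<close>

definition pair_sums :: "'a set" where
  "pair_sums = (\<lambda>X. \<Sum>X) ` {X. X \<subseteq> S \<and> card X = 2}"

text \<open>This is the set U. If \<open>S\<close> is 0 together with the columns of a parity check
  matrix, its elements are the syndromes of the cosets of minimum weight at least 3.\<close>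

definition gaps :: "'a set" where
  "gaps = V - insert 0 pair_sums"

definition uncovered :: "'a \<Rightarrow> 'a set" where
  "uncovered p = {a \<in> S. p + a \<in> gaps}"

definition triples :: "'a \<Rightarrow> 'a set set" where
  "triples p = {X. X \<subseteq> S \<and> card X = 3 \<and> \<Sum>X = p}"

lemma mem_pair_sums_iff: "x \<in> pair_sums \<longleftrightarrow> (\<exists>a\<in>S. \<exists>b\<in>S. a \<noteq> b \<and> x = a + b)"
proof
  assume "x \<in> pair_sums"
  then obtain a b where "{a, b} \<subseteq> S" "a \<noteq> b" "x = \<Sum>{a, b}"
    by (auto simp: pair_sums_def card_2_iff)
  then have "a \<in> S" "b \<in> S" "a \<noteq> b" "x = a + b"
    by simp_all
  then show "\<exists>a\<in>S. \<exists>b\<in>S. a \<noteq> b \<and> x = a + b"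
    by blast
next
  assume "\<exists>a\<in>S. \<exists>b\<in>S. a \<noteq> b \<and> x = a + b"
  then obtain a b where "a \<in> S" "b \<in> S" "a \<noteq> b" "x = a + b" by blast
  then show "x \<in> pair_sums"
    by (auto simp: pair_sums_def intro!: image_eqI [of _ _ "{a, b}"])
qed

lemma card_pair_sums: "card pair_sums = card S choose 2"
proof -
  have "inj_on (\<lambda>X. \<Sum>X) {X. X \<subseteq> S \<and> card X = 2}"
    by (auto simp: inj_on_def card_2_iff dest!: sidon_eq [rotated 5])
  then show ?thesis
    by (simp add: pair_sums_def card_image n_subsets [OF finite_S])
qed

lemma finite_gaps: "finite gaps"
  by (simp add: gaps_def finite_V)

text \<open>\<open>V\<close> splits into 0, the pair sums and the gaps. Doubling clears the
  denominator of the binomial coefficient.\<close>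

lemma double_card_gaps: "2 * card gaps + card S * (card S - 1) + 2 = 2 * card V"
proof -
  have sub: "insert 0 pair_sums \<subseteq> V"
    using zero_in_V add_in_V subsetD [OF S_subset_V] by (auto simp: mem_pair_sums_iff)
  have "0 \<notin> pair_sums"
    by (metis mem_pair_sums_iff add_eq_0_iff_eq)
  moreover have "finite pair_sums"
    using sub by (auto intro: finite_subset [OF _ finite_V])
  ultimately have "card (insert 0 pair_sums) = Suc (card S choose 2)"
    by (simp add: card_pair_sums)
  then have "card gaps + Suc (card S choose 2) = card V"
    using card_mono [OF finite_V sub] card_Diff_subset [OF finite_subset [OF sub finite_V] sub]
    by (simp add: gaps_def)
  moreover have "even (card S * (card S - 1))"
    by (simp add: even_mult_iff) presburger
  then have "2 * (card S choose 2) = card S * (card S - 1)"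
    by (simp add: choose_two)
  ultimately show ?thesis by linarith
qed

lemma finite_uncovered: "finite (uncovered p)"
  by (simp add: uncovered_def finite_S)

text \<open>Double counting: a point \<open>a\<close> of \<open>S\<close> and a gap \<open>u\<close>
  determine \<open>p = u + a\<close>. Such a \<open>p\<close> lies outside \<open>S\<close>, since
  otherwise \<open>u = p + a\<close> would be 0 or a pair sum.\<close>

lemma sum_card_uncovered: "(\<Sum>p\<in>V - S. card (uncovered p)) = card S * card gaps"
proof -
  have "bij_betw (\<lambda>(a, u). (u + a, a)) (S \<times> gaps) (SIGMA p:V - S. uncovered p)"
  proof (rule bij_betwI [where g = "\<lambda>(p, a). (a, p + a)"])
    show "(\<lambda>(a, u). (u + a, a)) \<in> S \<times> gaps \<rightarrow> (SIGMA p:V - S. uncovered p)"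
    proof (rule funcsetI, erule SigmaE, simp only: prod.case)
      fix a u assume a: "a \<in> S" and u: "u \<in> gaps"
      have "u + a \<in> V" using a u S_subset_V add_in_V by (auto simp: gaps_def)
      moreover have "u + a \<notin> S"
      proof
        assume "u + a \<in> S"
        moreover have "u = (u + a) + a" by (simp add: add.assoc add_self)
        moreover have "u \<noteq> 0" using u by (simp add: gaps_def)
        ultimately have "u \<in> pair_sums"
          using a by (metis mem_pair_sums_iff add_self)
        then show False using u by (simp add: gaps_def)
      qed
      ultimately show "(u + a, a) \<in> (SIGMA p:V - S. uncovered p)"
        using a u by (simp add: uncovered_def add.assoc add_self)
    qed
  qed (auto simp: uncovered_def add.assoc add_self)
  then have "card (S \<times> gaps) = card (SIGMA p:V - S. uncovered p)"
    by (rule bij_betw_same_card)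
  then show ?thesis
    by (simp add: finite_V finite_uncovered card_cartesian_product)
qed

text \<open>Two triples sharing a point \<open>a\<close> have remaining pairs with the same sum
  \<open>p + a\<close>, so the Sidon property identifies these pairs.\<close>

lemma disjnt_triples:
  assumes "X \<in> triples p" "Y \<in> triples p" "X \<noteq> Y"
  shows "X \<inter> Y = {}"
proof (rule ccontr)
  assume "X \<inter> Y \<noteq> {}"
  then obtain a where a: "a \<in> X" "a \<in> Y" by blast
  have split: "\<exists>b c. X = {a, b, c} \<and> b \<in> S \<and> c \<in> S \<and> b \<noteq> c \<and> p + a = b + c"
    if "X \<in> triples p" "a \<in> X" for X
  proof -
    have X: "X \<subseteq> S" "card X = 3" "\<Sum>X = p" using that by (auto simp: triples_def)
    have fin: "finite X" using X(2) card.infinite by fastforce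
    have "card (X - {a}) = 2" using X that fin by simp
    then obtain b c where bc: "X - {a} = {b, c}" "b \<noteq> c" by (auto simp: card_2_iff)
    have "p = a + (b + c)"
      using X(3) sum.remove [OF fin that(2), of "\<lambda>x. x"] bc by simp
    then have "p + a = b + c"
      by (simp add: add.commute add_self_left)
    moreover have "X = {a, b, c}" using bc that by blast
    ultimately show ?thesis using X bc by blast
  qed
  from split [OF assms(1) a(1)] split [OF assms(2) a(2)] assms(3)
  show False by (metis sidon_eq)
qed

text \<open>For \<open>p\<close> outside \<open>S\<close> the sum \<open>p + a\<close> is nonzero,
  so it is either a gap or a pair sum \<open>b + c\<close>. In the latter case \<open>a\<close>
  differs from \<open>b\<close> and \<open>c\<close>, because a coincidence would leave
  \<open>p\<close> equal to the other one, hence in \<open>S\<close>.\<close>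

lemma Union_triples:
  assumes "p \<notin> S" "p \<in> V"
  shows "\<Union>(triples p) = S - uncovered p"
proof (intro equalityI subsetI)
  fix a assume "a \<in> \<Union>(triples p)"
  then obtain X where X: "X \<subseteq> S" "card X = 3" "\<Sum>X = p" "a \<in> X"
    by (auto simp: triples_def)
  have fin: "finite X" using X(2) card.infinite by fastforce
  have "p = a + \<Sum>(X - {a})"
    using X(3) sum.remove [OF fin X(4), of "\<lambda>x. x"] by simp
  then have "p + a = \<Sum>(X - {a})"
    by (simp add: add.commute add_self_left)
  moreover have "card (X - {a}) = 2" using X fin by simp
  ultimately have "p + a \<in> pair_sums" using X by (auto simp: pair_sums_def)
  then show "a \<in> S - uncovered p" using X by (auto simp: uncovered_def gaps_def)
next
  fix a assume a: "a \<in> S - uncovered p"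
  then have "p + a \<in> V" using S_subset_V assms add_in_V by blast
  moreover have "p + a \<noteq> 0" using a assms by (auto simp: add_eq_0_iff_eq)
  ultimately have "p + a \<in> pair_sums" using a by (auto simp: uncovered_def gaps_def)
  then obtain b c where bc: "b \<in> S" "c \<in> S" "b \<noteq> c" "p + a = b + c"
    by (auto simp: mem_pair_sums_iff)
  have p: "p = b + c + a" using bc(4) by (simp add: add_eq_swap)
  have "a \<noteq> b" "a \<noteq> c"
    using p assms bc by (auto simp: add.commute add.left_commute add_self_left add_self)
  then have "{a, b, c} \<in> triples p"
    using a bc p by (auto simp: triples_def ac_simps)
  then show "a \<in> \<Union>(triples p)" by blast
qed

lemma finite_triples: "finite (triples p)"
  by (rule finite_subset [of _ "Pow S"]) (auto simp: triples_def finite_S)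

lemma sum_const_parity: "finite I \<Longrightarrow> (\<Sum>i\<in>I. p :: 'a) = (if even (card I) then 0 else p)"
  by (induction I rule: finite_induct) (auto simp: add_self)

lemma card_S_eq:
  assumes "p \<notin> S" "p \<in> V"
  shows "card S = card (uncovered p) + 3 * card (triples p)"
proof -
  have "card (\<Union>(triples p)) = (\<Sum>X\<in>triples p. card X)"
  proof (rule card_Union_disjoint)
    show "pairwise disjnt (triples p)"
      by (simp add: pairwise_def disjnt_def disjnt_triples)
  qed (auto simp: triples_def intro: card_ge_0_finite)
  also have "\<dots> = 3 * card (triples p)"
    by (simp add: triples_def)
  finally have "card (S - uncovered p) = 3 * card (triples p)"
    by (simp add: Union_triples [OF assms])
  moreover have "uncovered p \<subseteq> S" by (auto simp: uncovered_def)
  ultimately show ?thesis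
    using card_Diff_subset [OF finite_uncovered, of p S] card_mono [OF finite_S, of "uncovered p"]
    by simp
qed

lemma sum_S_eq:
  assumes "p \<notin> S" "p \<in> V"
  shows "\<Sum>S = \<Sum>(uncovered p) + (if even (card (triples p)) then 0 else p)"
proof -
  have "\<Sum>(\<Union>(triples p)) = (\<Sum>X\<in>triples p. \<Sum>X)"
  proof (subst sum.Union_disjoint)
    show "\<forall>X\<in>triples p. finite X"
      by (auto simp: triples_def intro: card_ge_0_finite)
    show "\<forall>X\<in>triples p. \<forall>Y\<in>triples p. X \<noteq> Y \<longrightarrow> X \<inter> Y = {}"
      by (simp add: disjnt_triples)
  qed simp
  also have "\<dots> = (\<Sum>X\<in>triples p. p)"
    by (simp add: triples_def)
  finally have "\<Sum>(S - uncovered p) = (if even (card (triples p)) then 0 else p)"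
    by (simp add: Union_triples [OF assms] sum_const_parity finite_triples)
  moreover have "uncovered p \<subseteq> S" by (auto simp: uncovered_def)
  ultimately show ?thesis
    using sum.subset_diff [of "uncovered p" S "\<lambda>x. x"] finite_S by (simp add: add.commute)
qed

section \<open>Lower bounds for the number of gaps by residue class of \<open>card S\<close>\<close>

text \<open>The values \<open>card (uncovered p)\<close> are summed over all \<open>p\<close>
  outside \<open>S\<close>. In the applications they are constant modulo 3, so an exceptional point
  misses the generic minimum \<open>m\<close> by at most 3.\<close>

lemma gaps_bound:
  assumes lower: "\<And>p. p \<in> V - S \<Longrightarrow> p \<notin> E \<Longrightarrow> m \<le> card (uncovered p)"
    and exceptional: "\<And>p. p \<in> V - S \<Longrightarrow> m \<le> card (uncovered p) + 3"
    and E: "finite E" "card E \<le> e"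
  shows "m * (card V - card S) \<le> card S * card gaps + 3 * e"
proof -
  have "m * (card V - card S) = (\<Sum>p\<in>V - S. m)"
    using S_subset_V finite_S by (simp add: card_Diff_subset)
  also have "\<dots> \<le> (\<Sum>p\<in>V - S. card (uncovered p) + (if p \<in> E then 3 else 0))"
    using lower exceptional by (intro sum_mono) auto
  also have "\<dots> = card S * card gaps + (\<Sum>p\<in>(V - S) \<inter> E. 3)"
    by (simp add: sum.distrib sum_card_uncovered sum.If_cases finite_V Int_def)
  also have "(\<Sum>p\<in>(V - S) \<inter> E. 3) \<le> 3 * e"
    using card_mono [of E "(V - S) \<inter> E"] E by simp
  finally show ?thesis by simp
qed

text \<open>If nothing is uncovered, \<open>S\<close> is a union of an odd number of triples, so
  \<open>p\<close> is the sum of \<open>S\<close>: one exceptional point.\<close>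

lemma gaps_bound_odd_0:
  assumes "odd (card S)" "card S mod 3 = 0"
  shows "3 * (card V - card S) \<le> card S * card gaps + 3"
proof -
  have "3 * (card V - card S) \<le> card S * card gaps + 3 * 1"
  proof (rule gaps_bound [where E = "{\<Sum>S}"])
    fix p assume p: "p \<in> V - S" "p \<notin> {\<Sum>S}"
    have "uncovered p \<noteq> {}"
    proof
      assume "uncovered p = {}"
      then show False using card_S_eq [of p] sum_S_eq [of p] p assms by (auto split: if_splits)
    qed
    then have "card (uncovered p) \<noteq> 0" by (simp add: finite_uncovered)
    then show "3 \<le> card (uncovered p)" using card_S_eq [of p] p assms by (simp; presburger)
  qed auto
  then show ?thesis by simp
qed

text \<open>A single uncovered point \<open>a\<close> leaves an even number of triples, so
  \<open>a\<close> is the sum of \<open>S\<close>. As \<open>p + a\<close> is a gap, the exceptional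
  points lie in a translate of \<open>gaps\<close>.\<close>

lemma gaps_bound_odd_1:
  assumes "odd (card S)" "card S mod 3 = 1"
  shows "4 * (card V - card S) \<le> (card S + 3) * card gaps"
proof -
  have "4 * (card V - card S) \<le> card S * card gaps + 3 * card gaps"
  proof (rule gaps_bound [where E = "(\<lambda>u. u + \<Sum>S) ` gaps"])
    fix p assume p: "p \<in> V - S" "p \<notin> (\<lambda>u. u + \<Sum>S) ` gaps"
    have mod3: "card S = card (uncovered p) + 3 * card (triples p)" using card_S_eq p by simp
    have "card (uncovered p) \<noteq> 1"
    proof
      assume c1: "card (uncovered p) = 1"
      then obtain a where a: "uncovered p = {a}" by (auto simp: card_1_singleton_iff)
      have "even (card (triples p))" using mod3 c1 assms by presburger
      then have "\<Sum>S = a" using sum_S_eq [of p] p a by simp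
      moreover have "p + a \<in> gaps" using a by (auto simp: uncovered_def)
      ultimately show False using p by (metis add_eq_swap image_eqI)
    qed
    then show "4 \<le> card (uncovered p)" using mod3 assms by presburger
  next
    fix p assume "p \<in> V - S"
    then show "4 \<le> card (uncovered p) + 3" using card_S_eq [of p] assms by (simp; presburger)
  qed (auto simp: finite_gaps card_image_le)
  then show ?thesis by (simp add: algebra_simps)
qed

text \<open>The Johnson bound by itself, with no exceptional points; it serves the case of odd
  \<open>card S\<close>.\<close>

lemma gaps_bound_2:
  assumes "card S mod 3 = 2"
  shows "2 * (card V - card S) \<le> card S * card gaps"
proof -
  have "2 \<le> card (uncovered p)" if "p \<in> V - S" for p
    using card_S_eq [of p] that assms by (simp; presburger)
  then have "2 * (card V - card S) \<le> card S * card gaps + 3 * 0"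
    by (intro gaps_bound [where E = "{}"]) (auto intro: le_trans)
  then show ?thesis by simp
qed

text \<open>Here a single uncovered point \<open>a\<close> leaves an odd number of triples, so
  \<open>p\<close> is \<open>a\<close> plus the sum of \<open>S\<close>. This allows at most one
  exceptional point for each element of \<open>S\<close>.\<close>

lemma gaps_bound_even_1:
  assumes "even (card S)" "card S mod 3 = 1"
  shows "4 * (card V - card S) \<le> card S * card gaps + 3 * card S"
proof (rule gaps_bound [where E = "(\<lambda>a. a + \<Sum>S) ` S"])
  fix p assume p: "p \<in> V - S" "p \<notin> (\<lambda>a. a + \<Sum>S) ` S"
  have mod3: "card S = card (uncovered p) + 3 * card (triples p)" using card_S_eq p by simp
  have "card (uncovered p) \<noteq> 1"
  proof
    assume c1: "card (uncovered p) = 1"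
    then obtain a where a: "uncovered p = {a}" by (auto simp: card_1_singleton_iff)
    have "odd (card (triples p))" using mod3 c1 assms by presburger
    then have "p = a + \<Sum>S" using sum_S_eq [of p] p a by (simp add: add_self_left)
    moreover have "a \<in> S" using a by (auto simp: uncovered_def)
    ultimately show False using p by blast
  qed
  then show "4 \<le> card (uncovered p)" using mod3 assms by presburger
next
  fix p assume "p \<in> V - S"
  then show "4 \<le> card (uncovered p) + 3" using card_S_eq [of p] assms by (simp; presburger)
qed (auto simp: finite_S card_image_le)

text \<open>Two uncovered points \<open>a\<close>, \<open>b\<close> leave an even number of triples,
  so \<open>a + b\<close> is the sum of \<open>S\<close>. By the Sidon property the pair is the same
  for every exceptional \<open>p\<close>, and translation by \<open>a\<close> embeds these points
  into \<open>gaps\<close>.\<close>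

lemma gaps_bound_even_2:
  assumes "even (card S)" "card S mod 3 = 2"
  shows "5 * (card V - card S) \<le> (card S + 3) * card gaps"
proof -
  define E where "E = {p \<in> V - S. card (uncovered p) = 2}"
  have E: "uncovered p \<subseteq> S \<and> (\<exists>a b. uncovered p = {a, b} \<and> a \<noteq> b \<and> \<Sum>S = a + b)" if "p \<in> E" for p
  proof -
    from that have p: "p \<in> V - S" "card (uncovered p) = 2" by (auto simp: E_def)
    then obtain a b where "uncovered p = {a, b}" "a \<noteq> b" by (auto simp: card_2_iff)
    moreover have "even (card (triples p))" using card_S_eq [of p] p assms by simp
    ultimately show ?thesis using sum_S_eq [of p] p by (auto simp: uncovered_def)
  qed
  have "card E \<le> card gaps"
  proof (cases "E = {}")
    case False
    then obtain q where q1: "q \<in> E" by blast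
    with E [OF q1] obtain a b where q: "q \<in> E" "uncovered q = {a, b}" "a \<noteq> b" "\<Sum>S = a + b"
      by blast
    have "p + a \<in> gaps" if "p \<in> E" for p
    proof -
      have "uncovered p = {a, b}"
        using E [OF that] E [OF q(1)] q sidon_eq by (metis insert_subset)
      then show ?thesis by (auto simp: uncovered_def)
    qed
    then show ?thesis
      by (intro card_inj_on_le [where f = "\<lambda>p. p + a"] finite_gaps) (auto simp: inj_on_def)
  qed simp
  then have "5 * (card V - card S) \<le> card S * card gaps + 3 * card gaps"
  proof (rule gaps_bound [where E = E, rotated 3])
    fix p assume p: "p \<in> V - S" "p \<notin> E"
    then have "card (uncovered p) \<noteq> 2" by (simp add: E_def)
    then show "5 \<le> card (uncovered p)" using card_S_eq [of p] p assms by (simp; presburger)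
  next
    fix p assume "p \<in> V - S"
    then show "5 \<le> card (uncovered p) + 3" using card_S_eq [of p] assms by (simp; presburger)
  qed (auto simp: E_def finite_V)
  then show ?thesis by (simp add: algebra_simps)
qed

end

section \<open>Arithmetic of \<open>n\<^sub>t\<close>\<close>

lemma Nt_bounds:
  "of_int (Nt t) \<le> sqrt (2 ^ (t + 1)) + 1/2" "sqrt (2 ^ (t + 1)) < of_int (Nt t) + 1/2"
  unfolding Nt_def by linarith+

text \<open>As \<open>lam t\<close> is at most 2, the first bound keeps the dimension
  \<open>n_t t - t\<close> nonnegative, and the second gives at least 10 points in the final
  estimates.\<close>

lemma Nt_ge:
  assumes "6 \<le> t"
  shows "int t + 4 \<le> Nt t" "11 \<le> Nt t"
proof -
  have "(t + 4)\<^sup>2 \<le> 2 ^ (t + 1)"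
    using assms
  proof (induction t rule: dec_induct)
    case (step t)
    have "(Suc t + 4)\<^sup>2 \<le> 2 * (t + 4)\<^sup>2"
      by (simp add: power2_eq_square algebra_simps)
    with step show ?case by simp
  qed simp
  then have "(real t + 4)\<^sup>2 \<le> 2 ^ (t + 1)"
    using of_nat_mono [of "(t + 4)\<^sup>2" "2 ^ (t + 1)", where 'a = real] by simp
  then have "real t + 4 \<le> sqrt (2 ^ (t + 1))"
    by (rule real_le_rsqrt)
  then show "int t + 4 \<le> Nt t"
    unfolding Nt_def by (simp add: le_floor_iff)
  have "(2::real) ^ 7 \<le> 2 ^ (t + 1)"
    by (rule power_increasing) (use assms in auto)
  then have "11 \<le> sqrt (2 ^ (t + 1))"
    by (intro real_le_rsqrt) simp
  then show "11 \<le> Nt t"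
    unfolding Nt_def by (simp add: le_floor_iff)
qed

text \<open>The hypothesis says x + 1/w <= \<open>Nt t\<close> + 1/2 for the square root x. Squaring
  gives the mixed term 2x/w >= 2c, and the square of 1/w makes the inequality strict.\<close>

lemma two_power_le_of_epst:
  assumes e: "epst t \<le> 1 - 1 / w" and w: "0 < w" and c: "0 \<le> c" "c * w \<le> sqrt (2 ^ (t + 1))"
  shows "2 ^ (t + 1) + 2 * c < of_int ((Nt t)\<^sup>2 + Nt t) + (1/4 :: real)"
proof -
  define x :: real where "x = sqrt (2 ^ (t + 1))"
  define y where "y = 1 / w"
  have y: "0 < y" using w by (simp add: y_def)
  have x: "0 \<le> x" "x\<^sup>2 = 2 ^ (t + 1)" by (simp_all add: x_def)
  have "x + y \<le> of_int (Nt t) + 1/2"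
    using e by (simp add: epst_def x_def y_def)
  then have "(x + y)\<^sup>2 \<le> (of_int (Nt t) + 1/2)\<^sup>2"
    using x y by (intro power_mono) auto
  then have "x\<^sup>2 + 2 * (x * y) + y\<^sup>2 \<le> (of_int (Nt t))\<^sup>2 + of_int (Nt t) + 1/4"
    by (simp add: power2_eq_square algebra_simps)
  moreover have "c \<le> x * y"
    using c w by (simp add: x_def y_def field_simps)
  moreover have "0 < y\<^sup>2" using y by simp
  ultimately show ?thesis
    unfolding x(2) of_int_add of_int_power by linarith
qed

text \<open>With r equal to t plus a constant, the first hypothesis becomes numerical. The constants
  11/2, 8 and 1/8 used below satisfy it as 121/4 <= 32, 64 = 64 and 1/64 = 1/64.\<close>

lemma powr_half_bound:
  assumes "c\<^sup>2 * 2 powr (r - real t - 1) \<le> 1" "0 \<le> c"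
  shows "c * 2 powr (r / 2) \<le> sqrt (2 ^ (t + 1))"
proof (rule real_le_rsqrt)
  have "(c * 2 powr (r / 2))\<^sup>2 = c\<^sup>2 * 2 powr r"
    by (simp add: power_mult_distrib powr_power)
  also have "2 powr r = 2 powr (r - real t - 1) * 2 powr (real (t + 1))"
    by (simp flip: powr_add)
  also have "\<dots> = 2 powr (r - real t - 1) * 2 ^ (t + 1)"
    by (simp only: powr_realpow zero_less_numeral)
  finally have "(c * 2 powr (r / 2))\<^sup>2 = (c\<^sup>2 * 2 powr (r - real t - 1)) * 2 ^ (t + 1)"
    by simp
  also have "\<dots> \<le> 1 * 2 ^ (t + 1)"
    using assms by (intro mult_right_mono) auto
  finally show "(c * 2 powr (r / 2))\<^sup>2 \<le> 2 ^ (t + 1)" by simp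
qed

lemma two_power_le_Nt: "(2::int) ^ (t + 1) \<le> (Nt t)\<^sup>2 + Nt t"
proof -
  define x :: real where "x = sqrt (2 ^ (t + 1))"
  have x: "0 \<le> x" "x\<^sup>2 = 2 ^ (t + 1)" by (simp_all add: x_def)
  have "x < of_int (Nt t) + 1/2" using Nt_bounds by (simp add: x_def)
  then have "x\<^sup>2 < (of_int (Nt t) + 1/2)\<^sup>2"
    using x by (intro power_strict_mono) auto
  then have "of_int (2 ^ (t + 1)) < (of_int ((Nt t)\<^sup>2 + Nt t + 1) :: real)"
    using x by (simp add: power2_eq_square algebra_simps)
  then show ?thesis unfolding of_int_less_iff by simp
qed

lemma two_power_le_of_epst_half:
  assumes "epst t \<le> 1/2"
  shows "(2::int) ^ (t + 1) \<le> (Nt t)\<^sup>2"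
proof -
  have "sqrt (2 ^ (t + 1)) \<le> of_int (Nt t)"
    using assms by (simp add: epst_def)
  then have "(sqrt (2 ^ (t + 1)))\<^sup>2 \<le> (of_int (Nt t))\<^sup>2"
    by (intro power_mono) auto
  then have "of_int (2 ^ (t + 1)) \<le> (of_int ((Nt t)\<^sup>2) :: real)"
    by simp
  then show ?thesis unfolding of_int_le_iff .
qed

lemma two_power_le_of_epst_4:
  assumes "epst t \<le> 1 - 1 / 2 powr ((real t - 4) / 2)"
  shows "(2::int) ^ (t + 1) \<le> (Nt t)\<^sup>2 + Nt t - 11"
proof -
  have "11/2 * 2 powr ((real t - 4) / 2) \<le> sqrt (2 ^ (t + 1))"
    by (rule powr_half_bound) (simp_all add: powr_minus power2_eq_square)
  from two_power_le_of_epst [OF assms _ _ this]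
  have "of_int (2 ^ (t + 1) + 11) < (of_int ((Nt t)\<^sup>2 + Nt t + 1) :: real)" by simp
  then show ?thesis unfolding of_int_less_iff by simp
qed

lemma two_power_le_of_epst_5:
  assumes "epst t \<le> 1 - 1 / 2 powr ((real t - 5) / 2)"
  shows "(2::int) ^ (t + 1) \<le> (Nt t)\<^sup>2 + Nt t - 16"
proof -
  have "8 * 2 powr ((real t - 5) / 2) \<le> sqrt (2 ^ (t + 1))"
    by (rule powr_half_bound) (simp_all add: powr_minus power2_eq_square)
  from two_power_le_of_epst [OF assms _ _ this]
  have "of_int (2 ^ (t + 1) + 16) < (of_int ((Nt t)\<^sup>2 + Nt t + 1) :: real)" by simp
  then show ?thesis unfolding of_int_less_iff by simp
qed

lemma two_power_less_of_epst_7: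
  assumes "epst t \<le> 1 - 1 / 2 powr ((real t + 7) / 2)"
  shows "(2::int) ^ (t + 1) < (Nt t)\<^sup>2 + Nt t"
proof -
  have "1/8 * 2 powr ((real t + 7) / 2) \<le> sqrt (2 ^ (t + 1))"
    \<comment> \<open>Twice 1/8 is exactly the 1/4 in \<open>two_power_le_of_epst\<close>, so the
      strict inequality survives.\<close>
    by (rule powr_half_bound) (simp_all add: power2_eq_square)
  from two_power_le_of_epst [OF assms _ _ this]
  have "of_int (2 ^ (t + 1)) < (of_int ((Nt t)\<^sup>2 + Nt t) :: real)" by simp
  then show ?thesis unfolding of_int_less_iff .
qed

lemma lam_range: "0 \<le> lam t \<and> lam t \<le> 2"
  by (simp add: lam_def Let_def)

text \<open>The first alternative makes the number of gaps negative; each other one is paired with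
  the \<open>gaps_bound\<close> lemma of its residue class. The values 0, 1, 2 of
  \<open>lam t\<close> mean that s is N + 1, N, N - 1, and the parity of a with the value of b gives
  s modulo 6.\<close>

lemma n_t_cases:
  fixes t :: nat
  assumes t: "6 \<le> t"
  defines "s \<equiv> n_t t + 1" and "X \<equiv> (2::int) ^ (t + 1)"
  shows "X < s * (s - 1) + 2
    \<or> odd s \<and> s mod 3 = 0 \<and> X \<le> s * s + 2 * s + 1
    \<or> even s \<and> s mod 3 = 1 \<and> X \<le> s * s + 3 * s - 14
    \<or> odd s \<and> s mod 3 = 2 \<and> X < s * s + s
    \<or> odd s \<and> s mod 3 = 1 \<and> X \<le> s * s + 3 * s - 9
    \<or> even s \<and> s mod 3 = 2 \<and> X \<le> s * s + 3 * s + 2"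
proof -
  define N where "N = Nt t"
  define a where "a = (N - 4) div 3"
  define b where "b = (N - 4) mod 3"
  have N: "N = 3 * a + b + 4"
    by (simp add: a_def b_def)
  have b: "b = 0 \<or> b = 1 \<or> b = 2"
    unfolding b_def by presburger
  have N11: "11 \<le> N" using Nt_ge(2) [OF t] by (simp add: N_def)
  have X: "X \<le> N * N + N"
    using two_power_le_Nt [of t] by (simp add: X_def N_def power2_eq_square)
  have half: "X \<le> N * N" if "epst t \<le> 1/2"
    using two_power_le_of_epst_half [OF that] by (simp add: X_def N_def power2_eq_square)
  \<comment> \<open>For N = s + 1 one has N^2 + N = s^2 + 3s + 2, so subtracting 11 and 16 yields
    the constants 9 and 14 of the conclusion.\<close>
  have e4: "X \<le> N * N + N - 11" if "epst t \<le> 1 - 1 / 2 powr ((real t - 4) / 2)"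
    using two_power_le_of_epst_4 [OF that] by (simp add: X_def N_def power2_eq_square)
  have e5: "X \<le> N * N + N - 16" if "epst t \<le> 1 - 1 / 2 powr ((real t - 5) / 2)"
    using two_power_le_of_epst_5 [OF that] by (simp add: X_def N_def power2_eq_square)
  have e7: "X < N * N + N" if "epst t \<le> 1 - 1 / 2 powr ((real t + 7) / 2)"
    using two_power_less_of_epst_7 [OF that] by (simp add: X_def N_def power2_eq_square)
  have sN: "s = N - lam t + 1" by (simp add: s_def n_t_def N_def)
  note lam = lam_def [of t, folded N_def, folded a_def b_def, unfolded Let_def, folded a_def b_def]
  have s0: "X < s * (s - 1) + 2" if "lam t = 0"
    using X that by (simp add: sN algebra_simps)
  have s1: "s = N" if "lam t = 1" using that by (simp add: sN)
  have s2: "N = s + 1" if "lam t = 2" using that by (simp add: sN)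
  show ?thesis
  proof (cases "even a")
    case a: True
    from b show ?thesis
    proof (elim disjE)
      assume b0: "b = 0"
      show ?thesis
      proof (cases "epst t \<le> 1/2")
        case True
        then have s: "N = s + 1" using a b0 by (intro s2) (simp add: lam)
        moreover have "odd s" "s mod 3 = 0" using N a b0 s by presburger+
        ultimately show ?thesis using half [OF True] by (simp add: algebra_simps)
      next
        case False
        then have s: "s = N" using a b0 by (intro s1) (simp add: lam)
        moreover have "even s" "s mod 3 = 1" using N a b0 s by presburger+
        ultimately show ?thesis using X N11 by simp
      qed
    next
      assume b1: "b = 1"
      show ?thesis
      proof (cases "epst t \<le> 1 - 1 / 2 powr ((real t - 5) / 2)")
        case True
        then have s: "N = s + 1" using a b1 by (intro s2) (simp add: lam)
        moreover have "even s" "s mod 3 = 1" using N a b1 s by presburger+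
        ultimately show ?thesis using e5 [OF True] by (simp add: algebra_simps)
      next
        case n5: False
        show ?thesis
        proof (cases "epst t \<le> 1 - 1 / 2 powr ((real t + 7) / 2)")
          case True
          then have s: "s = N" using a b1 n5 by (intro s1) (simp add: lam)
          moreover have "odd s" "s mod 3 = 2" using N a b1 s by presburger+
          ultimately show ?thesis using e7 [OF True] by simp
        next
          case False
          then have "lam t = 0" using a b1 n5 by (simp add: lam)
          then show ?thesis using s0 by simp
        qed
      qed
    next
      assume "b = 2"
      then have "lam t = 0" using a by (simp add: lam)
      then show ?thesis using s0 by simp
    qed
  next
    case a: False
    from b show ?thesis
    proof (elim disjE)
      assume b0: "b = 0"
      have s: "s = N" using a b0 by (intro s1) (simp add: lam)
      moreover have "odd s" "s mod 3 = 1" using N a b0 s by presburger+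
      ultimately show ?thesis using X N11 by simp
    next
      assume b1: "b = 1"
      show ?thesis
      proof (cases "epst t \<le> 1 - 1 / 2 powr ((real t - 4) / 2)")
        case True
        then have s: "N = s + 1" using a b1 by (intro s2) (simp add: lam)
        moreover have "odd s" "s mod 3 = 1" using N a b1 s by presburger+
        ultimately show ?thesis using e4 [OF True] by (simp add: algebra_simps)
      next
        case False
        then have s: "s = N" using a b1 by (intro s1) (simp add: lam)
        moreover have "even s" "s mod 3 = 2" using N a b1 s by presburger+
        ultimately show ?thesis using X N11 by simp
      qed
    next
      assume b2: "b = 2"
      have s: "N = s + 1" using a b2 by (intro s2) (simp add: lam)
      moreover have "even s" "s mod 3 = 2" using N a b2 s by presburger+
      ultimately show ?thesis using X by (simp add: algebra_simps)
    qed
  qed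
qed

section \<open>Excluding Sidon sets with \<open>n_t t + 1\<close> points in the binary space\<close>

lemma add_self_bitfun: "(x :: nat \<Rightarrow> bit) + x = 0"
  by (rule ext) simp

lemma bij_betw_binvec: "bij_betw (\<lambda>A i. of_bool (i \<in> A)) (Pow {..<n}) (binvec n)"
proof (rule bij_betwI [where g = "\<lambda>v. {i. v i \<noteq> 0}"])
  show "(\<lambda>v. {i. v i \<noteq> 0}) \<in> binvec n \<rightarrow> Pow {..<n}"
    by (auto simp: binvec_def not_less [symmetric])
qed (auto simp: binvec_def of_bool_def fun_eq_iff)

lemma finite_binvec: "finite (binvec n)"
  using bij_betw_finite [OF bij_betw_binvec, of n] by simp

lemma card_binvec: "card (binvec n) = 2 ^ n"
  using bij_betw_same_card [OF bij_betw_binvec, of n] by (simp add: card_Pow)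

text \<open>Equal sums force a coincidence among the four points. Since a + b is nonzero, it occurs
  across the two pairs, and cancelling it matches the other two points.\<close>

lemma sidon_subset_binvec:
  assumes "M \<subseteq> binvec t" "sidon M"
  shows "sidon_subset (binvec t) M"
proof
  fix a b c d assume M: "a \<in> M" "b \<in> M" "c \<in> M" "d \<in> M" and ab: "a \<noteq> b" and eq: "a + b = c + d"
  have "c \<noteq> d"
  proof
    assume "c = d"
    then have "a + b = b + b" using eq by (simp add: add_self_bitfun)
    then show False using ab by simp
  qed
  moreover have "\<not> distinct [a, b, c, d]"
    using assms(2) M eq unfolding sidon_def by blast
  ultimately have "a = c \<or> a = d \<or> b = c \<or> b = d" using ab by auto
  then show "{a, b} = {c, d}"
    using eq by (auto simp: add.commute)
next
  show "finite (binvec t)" by (rule finite_binvec)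
qed (use assms in \<open>auto simp: add_self_bitfun binvec_def\<close>)

lemma no_sidon_set:
  assumes t: "6 \<le> t" and M: "M \<subseteq> binvec t" "sidon M" and card: "int (card M) = n_t t + 1"
  shows False
proof -
  interpret sidon_subset "binvec t" M using M by (rule sidon_subset_binvec)
  define s where "s = int (card M)"
  define X :: int where "X = 2 ^ (t + 1)"
  define g where "g = int (card gaps)"
  have s10: "10 \<le> s"
    using Nt_ge [OF t] lam_range [of t] card by (simp add: s_def n_t_def)
  then have ss: "10 * s \<le> s * s" by simp
  have "2 * card gaps + card M * (card M - 1) + 2 = 2 ^ (t + 1)"
    using double_card_gaps by (simp add: card_binvec)
  then have "int (2 * card gaps + card M * (card M - 1) + 2) = X"
    by (simp add: X_def)
  moreover have "int (card M - 1) = s - 1" using s10 by (simp add: s_def)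
  ultimately have "2 * g + s * (s - 1) + 2 = X"
    unfolding s_def g_def of_nat_add of_nat_mult by simp
  then have g: "2 * g = X - 2 - s * s + s"
    by (simp add: algebra_simps)
  have g0: "0 \<le> g" by (simp add: g_def)
  have "card M \<le> card (binvec t)"
    by (rule card_mono [OF finite_binvec M(1)])
  then have V: "2 * int (card (binvec t) - card M) = X - 2 * s"
    by (simp add: s_def X_def card_binvec of_nat_diff)
  \<comment> \<open>Bounds are doubled so that both X and 2g enter without division.\<close>
  have int_le: "m * (X - 2 * s) \<le> 2 * int r" if "nat m * (card (binvec t) - card M) \<le> r" "0 \<le> m" for m r
  proof -
    have "int (nat m * (card (binvec t) - card M)) \<le> int r" using that(1) by (rule of_nat_mono)
    then have "m * int (card (binvec t) - card M) \<le> int r" using that(2) by simp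
    then show ?thesis unfolding V [symmetric] by simp
  qed
  have "s mod 3 = int (card M mod 3)"
    by (simp add: s_def zmod_int)
  then have parity: "even (card M) \<longleftrightarrow> even s" "card M mod 3 = k \<longleftrightarrow> s mod 3 = int k" for k
    by (auto simp: s_def)
  from n_t_cases [OF t, folded card s_def X_def] consider
      "X < s * (s - 1) + 2"
    | "odd s" "s mod 3 = 0" "X \<le> s * s + 2 * s + 1"
    | "even s" "s mod 3 = 1" "X \<le> s * s + 3 * s - 14"
    | "odd s" "s mod 3 = 2" "X < s * s + s"
    | "odd s" "s mod 3 = 1" "X \<le> s * s + 3 * s - 9"
    | "even s" "s mod 3 = 2" "X \<le> s * s + 3 * s + 2"
    by blast
  \<comment> \<open>In cases 2 to 6, eliminating g leaves a lower bound for a positive multiple of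
    X. Against the upper bound on X the cubic terms cancel, and \<open>10 \<le> s\<close> refutes
    the rest.\<close>
  then show False
  proof cases
    case 1
    then show False using g g0 by (simp add: algebra_simps)
  next
    case 2
    have "3 * (X - 2 * s) \<le> 2 * int (card M * card gaps + 3)"
      using 2 by (intro int_le) (simp_all add: gaps_bound_odd_0 parity)
    then have "3 * (X - 2 * s) \<le> s * (2 * g) + 6" by (simp add: s_def g_def)
    then have "0 \<le> (s - 3) * X - s * s * s + s * s + 4 * s + 6"
      unfolding g by (simp add: algebra_simps)
    moreover have "(s - 3) * X \<le> (s - 3) * (s * s + 2 * s + 1)"
      using 2 s10 by (intro mult_left_mono) auto
    ultimately show False using s10 ss by (simp add: algebra_simps)
  next
    case 3
    have "4 * (X - 2 * s) \<le> 2 * int (card M * card gaps + 3 * card M)"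
      using 3 by (intro int_le) (simp_all add: gaps_bound_even_1 parity)
    then have "4 * (X - 2 * s) \<le> s * (2 * g) + 6 * s" by (simp add: s_def g_def)
    then have "0 \<le> (s - 4) * X - s * s * s + s * s + 12 * s"
      unfolding g by (simp add: algebra_simps)
    moreover have "(s - 4) * X \<le> (s - 4) * (s * s + 3 * s - 14)"
      using 3 s10 by (intro mult_left_mono) auto
    ultimately show False using s10 ss by (simp add: algebra_simps)
  next
    case 4
    have "2 * (X - 2 * s) \<le> 2 * int (card M * card gaps)"
      using 4 by (intro int_le) (simp_all add: gaps_bound_2 parity)
    then have "2 * (X - 2 * s) \<le> s * (2 * g)" by (simp add: s_def g_def)
    then have "0 \<le> (s - 2) * X - s * s * s + s * s + 2 * s"
      unfolding g by (simp add: algebra_simps)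
    moreover have "(s - 2) * X \<le> (s - 2) * (s * s + s - 1)"
      using 4 s10 by (intro mult_left_mono) auto
    ultimately show False using s10 ss by (simp add: algebra_simps)
  next
    case 5
    have "4 * (X - 2 * s) \<le> 2 * int ((card M + 3) * card gaps)"
      using 5 by (intro int_le) (simp_all add: gaps_bound_odd_1 [simplified] parity)
    then have "4 * (X - 2 * s) \<le> (s + 3) * (2 * g)" by (simp add: s_def g_def)
    then have "0 \<le> (s - 1) * X - s * s * s - 2 * (s * s) + 9 * s - 6"
      unfolding g by (simp add: algebra_simps)
    moreover have "(s - 1) * X \<le> (s - 1) * (s * s + 3 * s - 9)"
      using 5 s10 by (intro mult_left_mono) auto
    ultimately show False using s10 ss by (simp add: algebra_simps)
  next
    case 6
    have "5 * (X - 2 * s) \<le> 2 * int ((card M + 3) * card gaps)"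
      using 6 by (intro int_le) (simp_all add: gaps_bound_even_2 [simplified] parity)
    then have "5 * (X - 2 * s) \<le> (s + 3) * (2 * g)" by (simp add: s_def g_def)
    then have "0 \<le> (s - 2) * X - s * s * s - 2 * (s * s) + 11 * s - 6"
      unfolding g by (simp add: algebra_simps)
    moreover have "(s - 2) * X \<le> (s - 2) * (s * s + 3 * s + 2)"
      using 6 s10 by (intro mult_left_mono) auto
    ultimately show False using s10 ss by (simp add: algebra_simps)
  qed
qed

section \<open>Sidon sets from linear codes\<close>

definition unit_vec :: "nat \<Rightarrow> nat \<Rightarrow> bit" where
  "unit_vec i = (\<lambda>j. of_bool (j = i))"

interpretation F2: vector_space F2scale
  by standard (auto simp: F2scale_def fun_eq_iff algebra_simps)

interpretation F2_pair: vector_space_pair F2scale F2scale ..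

lemma inj_unit_vec: "inj unit_vec"
  by (auto simp: inj_def unit_vec_def fun_eq_iff)

lemma sum_unit_vec:
  assumes "finite I"
  shows "(\<Sum>i\<in>I. unit_vec i) = (\<lambda>j. of_bool (j \<in> I))"
  using assms by (induction I rule: finite_induct) (auto simp: unit_vec_def fun_eq_iff)

lemma binvec_eq_sum_unit_vec:
  assumes "v \<in> binvec n"
  shows "v = (\<Sum>i\<in>{i \<in> {..<n}. v i \<noteq> 0}. unit_vec i)"
proof -
  have "finite {i \<in> {..<n}. v i \<noteq> 0}" by simp
  from sum_unit_vec [OF this] show ?thesis
    using assms by (auto simp: fun_eq_iff binvec_def not_less [symmetric])
qed

lemma unit_vec_in_binvec: "i < n \<Longrightarrow> unit_vec i \<in> binvec n"
  by (auto simp: unit_vec_def binvec_def)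

lemma subspace_binvec: "F2.subspace (binvec n)"
  by (auto simp: F2.subspace_def binvec_def F2scale_def)

lemma span_unit_vec: "F2.span (unit_vec ` {..<n}) = binvec n"
proof
  show "F2.span (unit_vec ` {..<n}) \<subseteq> binvec n"
    by (rule F2.span_minimal) (auto simp: unit_vec_in_binvec subspace_binvec)
  show "binvec n \<subseteq> F2.span (unit_vec ` {..<n})"
  proof
    fix v assume "v \<in> binvec n"
    moreover have "(\<Sum>i\<in>{i \<in> {..<n}. v i \<noteq> 0}. unit_vec i) \<in> F2.span (unit_vec ` {..<n})"
      by (rule F2.span_sum) (simp add: F2.span_base)
    ultimately show "v \<in> F2.span (unit_vec ` {..<n})"
      by (metis binvec_eq_sum_unit_vec)
  qed
qed

lemma independent_unit_vec: "F2.independent (unit_vec ` {..<n})"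
proof (induction n)
  case (Suc n)
  have "unit_vec n \<notin> binvec n" by (auto simp: unit_vec_def binvec_def)
  with Suc show ?case
    by (simp add: lessThan_Suc F2.independent_insertI span_unit_vec)
qed (simp add: F2.independent_empty)

lemma dim_binvec: "F2.dim (binvec n) = n"
  using F2.dim_span_eq_card_independent [OF independent_unit_vec, of n]
  by (simp add: span_unit_vec card_image inj_on_subset [OF inj_unit_vec])

text \<open>A basis of \<open>C\<close> is extended to one of the whole space. The map kills the
  former and sends the t added vectors to the unit vectors, so it is injective on their span and its
  kernel lies in \<open>C\<close>.\<close>

lemma exists_parity_check_map:
  assumes C: "F2.subspace C" "C \<subseteq> binvec n" and dim: "F2.dim C = n - t" and "t \<le> n"
  obtains f where "Vector_Spaces.linear F2scale F2scale f"
    "\<And>v. v \<in> binvec n \<Longrightarrow> f v \<in> binvec t" "\<And>v. v \<in> binvec n \<Longrightarrow> f v = 0 \<Longrightarrow> v \<in> C"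
proof -
  obtain B where B: "B \<subseteq> C" "F2.independent B" "C \<subseteq> F2.span B" "card B = F2.dim C"
    by (rule F2.basis_exists)
  have "B \<subseteq> binvec n" using B C by blast
  then obtain B' where B': "B \<subseteq> B'" "B' \<subseteq> binvec n" "F2.independent B'" "binvec n \<subseteq> F2.span B'"
    using B(2) by (rule F2.maximal_independent_subset_extend)
  have "card B' = n"
    using F2.basis_card_eq_dim [OF B'(2,4,3)] by (simp add: dim_binvec)
  moreover have "finite B'" using B'(2) finite_binvec by (rule finite_subset)
  ultimately have "card (B' - B) = t"
    using B(4) B'(1) dim \<open>t \<le> n\<close> by (simp add: card_Diff_subset finite_subset)
  then obtain g where g: "bij_betw g (B' - B) {..<t}"
    using finite_same_card_bij [of "B' - B" "{..<t}"] \<open>finite B'\<close> by auto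
  define h where "h b = (if b \<in> B then 0 else unit_vec (g b))" for b
  obtain f where f: "Vector_Spaces.linear F2scale F2scale f" "\<forall>b\<in>B'. f b = h b"
    using F2_pair.linear_independent_extend [OF B'(3), of h] by blast
  interpret f: Vector_Spaces.linear F2scale F2scale f by (rule f(1))
  have fB: "f x = 0" if "x \<in> F2.span B" for x
    by (rule f.eq_0_on_span [OF _ that]) (use f(2) B'(1) in \<open>auto simp: h_def\<close>)
  have image: "f ` (B' - B) = unit_vec ` {..<t}"
  proof -
    have "f ` (B' - B) = unit_vec ` g ` (B' - B)"
      unfolding image_image by (rule image_cong) (use f(2) in \<open>auto simp: h_def\<close>)
    then show ?thesis using g by (simp add: bij_betw_def)
  qed
  have "inj_on f (B' - B)"
  proof (rule inj_onI)
    fix x y assume "x \<in> B' - B" "y \<in> B' - B" "f x = f y"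
    then show "x = y"
      using f(2) g inj_unit_vec by (auto simp: h_def bij_betw_def inj_on_def inj_def)
  qed
  then have inj: "inj_on f (F2.span (B' - B))"
    by (intro f.inj_on_span_independent_image) (simp_all add: image independent_unit_vec)
  have dec: "\<exists>x y. v = x + y \<and> x \<in> F2.span B \<and> y \<in> F2.span (B' - B)" if "v \<in> binvec n" for v
  proof -
    have "B \<union> (B' - B) = B'" using B'(1) by blast
    then have "v \<in> F2.span (B \<union> (B' - B))" using that B'(4) by auto
    then show ?thesis unfolding F2.span_Un by blast
  qed
  show thesis
  proof (rule that [OF f(1)])
    fix v assume v: "v \<in> binvec n"
    obtain x y where xy: "v = x + y" "x \<in> F2.span B" "y \<in> F2.span (B' - B)"
      using dec [OF v] by blast
    have fv: "f v = f y" using xy fB by (simp add: f.add)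
    have "f ` F2.span (B' - B) = binvec t"
      by (simp add: f.span_image [symmetric] image span_unit_vec)
    then show "f v \<in> binvec t" using xy fv by auto
    assume "f v = 0"
    then have "f y = f 0" using fv by simp
    then have "y = 0" by (rule inj_onD [OF inj _ xy(3) F2.span_zero])
    then have "v \<in> F2.span B" using xy by simp
    moreover have "F2.span B \<subseteq> C" by (rule F2.span_minimal [OF B(1) C(1)])
    ultimately show "v \<in> C" by blast
  qed
qed

text \<open>The points are 0 and the images of the unit vectors. A repeated point or a violation of
  the Sidon property is a nontrivial dependence among at most four images, hence a nonzero codeword
  of weight at most 4.\<close>

lemma sidon_set_of_code:
  assumes C: "bin_linear_code n (n - t) d C" and d: "5 \<le> d" and "t \<le> n"
  obtains M where "M \<subseteq> binvec t" "sidon M" "card M = n + 1"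
proof -
  from C have sub: "C \<subseteq> binvec n" "F2.subspace C" "F2.dim C = n - t"
    and d_def: "Min (hweight ` (C - {0})) = d"
    by (auto simp: bin_linear_code_def)
  obtain f where f: "Vector_Spaces.linear F2scale F2scale f"
    "\<And>v. v \<in> binvec n \<Longrightarrow> f v \<in> binvec t" "\<And>v. v \<in> binvec n \<Longrightarrow> f v = 0 \<Longrightarrow> v \<in> C"
    using exists_parity_check_map [OF sub(2,1,3) \<open>t \<le> n\<close>] by blast
  interpret f: Vector_Spaces.linear F2scale F2scale f by (rule f(1))
  \<comment> \<open>For the zero code \<open>Min\<close> is taken over the empty set, but then the
    claim is vacuous.\<close>
  have weight: "5 \<le> hweight c" if "c \<in> C" "c \<noteq> 0" for c
  proof -
    have "finite (hweight ` (C - {0}))"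
      using finite_subset [OF sub(1) finite_binvec] by simp
    then have "Min (hweight ` (C - {0})) \<le> hweight c"
      using that by (intro Min_le) auto
    then show ?thesis using d d_def by simp
  qed
  have small: "I = {}" if I: "I \<subseteq> {..<n}" "card I \<le> 4" "(\<Sum>i\<in>I. f (unit_vec i)) = 0" for I
  proof (rule ccontr)
    assume "I \<noteq> {}"
    have fin: "finite I" using I(1) finite_subset by blast
    define c where "c = (\<Sum>i\<in>I. unit_vec i)"
    have c: "c = (\<lambda>j. of_bool (j \<in> I))" using sum_unit_vec [OF fin] by (simp add: c_def)
    have "c \<in> binvec n" using I(1) by (auto simp: c binvec_def)
    moreover have "f c = 0" using I(3) by (simp add: c_def f.sum)
    ultimately have "c \<in> C" by (rule f(3))
    moreover have "c \<noteq> 0" using \<open>I \<noteq> {}\<close> by (auto simp: c fun_eq_iff)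
    ultimately have "5 \<le> hweight c" by (rule weight)
    moreover have "hweight c = card I" by (simp add: c hweight_def)
    ultimately show False using I(2) by simp
  qed
  text \<open>Indexing by \<open>Suc\<close> puts the extra point \<open>0\<close> of the Sidon set at index \<open>0\<close>.\<close>
  define p where "p i = (case i of 0 \<Rightarrow> 0 | Suc j \<Rightarrow> f (unit_vec j))" for i
  \<comment> \<open>The index 0 contributes nothing to the sum, so \<open>I\<close> may still be {0}
    and need not be empty.\<close>
  have small_p: "card I < 2" if I: "I \<subseteq> {..n}" "card I \<le> 4" "(\<Sum>i\<in>I. p i) = 0" for I
  proof -
    have fin: "finite I" using I(1) finite_subset by blast
    define J where "J = {j. Suc j \<in> I}"
    have J: "Suc ` J = I - {0}"
      by (auto simp: J_def image_iff) (metis not0_implies_Suc)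
    have "card J = card (I - {0})"
      unfolding J [symmetric] by (simp add: card_image)
    moreover have "card (I - {0}) \<le> card I" using fin by (intro card_mono) auto
    moreover have "(\<Sum>j\<in>J. f (unit_vec j)) = (\<Sum>i\<in>I - {0}. p i)"
      unfolding J [symmetric] by (simp add: sum.reindex p_def)
    moreover have "(\<Sum>i\<in>I - {0}. p i) = (\<Sum>i\<in>I. p i)"
      using fin by (intro sum.mono_neutral_left) (auto simp: p_def)
    moreover have "J \<subseteq> {..<n}" using I(1) by (auto simp: J_def)
    ultimately have "J = {}" using I by (intro small) auto
    then have "I \<subseteq> {0}" using J by auto
    then show ?thesis using card_mono [of "{0}" I] by simp
  qed
  have inj: "inj_on p {..n}"
  proof (rule inj_onI, rule ccontr)
    fix i j assume ij: "i \<in> {..n}" "j \<in> {..n}" "p i = p j" "i \<noteq> j"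
    then have "card {i, j} < 2"
      by (intro small_p) (auto simp: add_self_bitfun)
    then show False using ij by simp
  qed
  show thesis
  proof (rule that)
    show "p ` {..n} \<subseteq> binvec t"
    proof
      fix x assume "x \<in> p ` {..n}"
      then obtain i where "i \<le> n" "x = p i" by blast
      then show "x \<in> binvec t"
        using f(2) [OF unit_vec_in_binvec] by (cases i) (simp_all add: p_def binvec_def)
    qed
    show "card (p ` {..n}) = n + 1" using inj by (simp add: card_image)
    show "sidon (p ` {..n})"
      unfolding sidon_def
    proof (intro ballI impI notI)
      fix a b c d
      assume "a \<in> p ` {..n}" "b \<in> p ` {..n}" "c \<in> p ` {..n}" "d \<in> p ` {..n}"
        and abcd: "distinct [a, b, c, d]" "a + b = c + d"
      then obtain i j k l where ijkl: "i \<in> {..n}" "j \<in> {..n}" "k \<in> {..n}" "l \<in> {..n}"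
        and eqs: "a = p i" "b = p j" "c = p k" "d = p l"
        by blast
      from abcd(1) have dist: "distinct [i, j, k, l]" by (auto simp: eqs)
      have "(p i + p j) + (p k + p l) = 0"
        using abcd(2) by (simp only: eqs add_self_bitfun)
      then have "p i + (p j + (p k + p l)) = 0" by (simp only: add.assoc)
      then have "card {i, j, k, l} < 2"
        using ijkl dist by (intro small_p) simp_all
      then show False using dist by simp
    qed
  qed
qed

section \<open>The maximum size of a Sidon set, with the value of the bound for odd t\<close>

lemma sidon_mono: "sidon M \<Longrightarrow> M' \<subseteq> M \<Longrightarrow> sidon M'"
  unfolding sidon_def by (meson subsetD)

lemma smax_le_n_t:
  assumes "6 \<le> t"
  shows "int (smax t) \<le> n_t t"
proof (rule ccontr)
  assume "\<not> ?thesis"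
  then have less: "n_t t + 1 \<le> int (smax t)" by simp
  have n_t: "0 \<le> n_t t + 1"
    using Nt_ge [OF assms] lam_range [of t] by (simp add: n_t_def)
  let ?K = "{M. M \<subseteq> binvec t \<and> sidon M}"
  have "finite ?K"
    by (rule finite_subset [of _ "Pow (binvec t)"]) (auto simp: finite_binvec)
  moreover have "{} \<in> ?K" by (simp add: sidon_def)
  ultimately have "Max (card ` ?K) \<in> card ` ?K"
    by (intro Max_in) blast+
  then obtain M where M: "M \<subseteq> binvec t" "sidon M" "card M = smax t"
    by (auto simp: smax_def)
  \<comment> \<open>Only the exact size \<open>n_t t + 1\<close> has been excluded, so a larger
    Sidon set is first cut down to it.\<close>
  obtain M' where M': "M' \<subseteq> M" "card M' = nat (n_t t + 1)"
  proof (rule obtain_subset_with_card_n [of "nat (n_t t + 1)" M])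
    show "nat (n_t t + 1) \<le> card M" using less M(3) by simp
  qed blast
  show False
  proof (rule no_sidon_set [OF assms])
    show "M' \<subseteq> binvec t" using M M' by blast
    show "sidon M'" using M M' sidon_mono by blast
    show "int (card M') = n_t t + 1" using M' n_t by simp
  qed
qed

text \<open>The square root is a power q of 2, so \<open>epst t\<close> is 1/2. As q is even and
  prime to 3, only a even with b = 0 or a odd with b = 1 can occur, and \<open>lam t\<close> is 2 in
  both.\<close>

lemma n_t_odd:
  assumes "6 \<le> t" "odd t"
  shows "n_t t = 2 ^ ((t + 1) div 2) - 2"
proof -
  obtain m where m: "t + 1 = 2 * m" using assms(2) by (metis even_Suc Suc_eq_plus1 evenE)
  define q :: int where "q = 2 ^ m"
  have "(2::real) ^ (t + 1) = (of_int q)\<^sup>2"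
    unfolding q_def m by (simp add: power_mult mult.commute [of 2 m])
  then have sqrt: "sqrt (2 ^ (t + 1)) = of_int q"
    by (simp add: q_def)
  have Nt: "Nt t = q"
    unfolding Nt_def sqrt by linarith
  then have e: "epst t = 1/2" using sqrt by (simp add: epst_def)
  \<comment> \<open>This puts the threshold for a odd, b = 1 at 1/2 or more.\<close>
  have "7 \<le> t" using assms by presburger
  then have "2 powr 1 \<le> 2 powr ((real t - 4) / 2)" by (intro powr_mono) auto
  then have e4: "epst t \<le> 1 - 1 / 2 powr ((real t - 4) / 2)" by (simp add: e field_simps)
  have "0 < m" using m by simp
  then have "even q" by (simp add: q_def)
  have "q mod 3 = 1 \<or> q mod 3 = 2"
    unfolding q_def by (induction m) (simp, simp, presburger)
  then have "lam t = 2"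
  proof
    assume "q mod 3 = 1"
    then have "(q - 4) mod 3 = 0" "even ((q - 4) div 3)" using \<open>even q\<close> by presburger+
    then show ?thesis by (simp add: lam_def Let_def Nt e)
  next
    assume "q mod 3 = 2"
    then have "(q - 4) mod 3 = 1" "odd ((q - 4) div 3)" using \<open>even q\<close> by presburger+
    then show ?thesis using e4 by (simp add: lam_def Let_def Nt)
  qed
  then show ?thesis using Nt m by (simp add: n_t_def q_def)
qed

theorem theorem4p3:
  fixes t :: nat
  assumes "t \<ge> 6"
  shows "\<not> (\<exists>C. bin_linear_code (nat (n_t t)) (nat (n_t t - int t)) 5 C)
         \<and> int (smax t) \<le> (if odd t then 2 ^ ((t + 1) div 2) - 2 else n_t t)"
proof (intro conjI notI)
  assume "\<exists>C. bin_linear_code (nat (n_t t)) (nat (n_t t - int t)) 5 C"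
  then obtain C where C: "bin_linear_code (nat (n_t t)) (nat (n_t t - int t)) 5 C" by blast
  \<comment> \<open>This makes the integer difference \<open>n_t t - int t\<close> agree with
    truncated subtraction on naturals.\<close>
  have n_t: "int t \<le> n_t t"
    using Nt_ge [OF assms] lam_range [of t] by (simp add: n_t_def)
  then have "nat (n_t t - int t) = nat (n_t t) - t" "t \<le> nat (n_t t)" by auto
  with C obtain M where "M \<subseteq> binvec t" "sidon M" "card M = nat (n_t t) + 1"
    using sidon_set_of_code [of "nat (n_t t)" t 5 C] by auto
  then show False using n_t by (intro no_sidon_set [OF assms, of M]) auto
next
  show "int (smax t) \<le> (if odd t then 2 ^ ((t + 1) div 2) - 2 else n_t t)"
    using smax_le_n_t [OF assms] by (cases "odd t") (simp_all add: n_t_odd [OF assms])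
qed

end
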